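(* There exists a $\Delta^0_2$ fuzzy set $A$ such that for every $\Delta^0_2$-approximation $f$ of $A$, the sequence $(m^f_\Sigma(0,s))_{s\in\omega}$ does not converge as $s \to \infty$. In particular, $A$ is not fuzzy $n$-c.e. for any $n \geq 1$.
   Context: A fuzzy subset of $\omega$ is a function $A\colon \omega \to [0;1]_{\mathbb{R}}$. $[0;1]_{\mathbb{Q}}$ denotes the rationals in $[0,1]$, coded effectively by natural numbers. A fuzzy set $A$ is $\Delta^0_2$ if there is a computable $f\colon \omega\times\omega\to[0;1]_{\mathbb{Q}}$ with $\lim_s f(x,s) = A(x)$ for all $x$; such an $f$ is called a $\Delta^0_2$-approximation of $A$. For a total $f\colon \omega\times\omega \to [0;1]_{\mathbb{Q}}$, its $\Sigma$-mind change function $m^f_\Sigma\colon \omega\times\omega \to \{-1,1\}$ is defined by: $m^f_\Sigma(x,0) = 1$; if $m^f_\Sigma(x,s)=1$, then $m^f_\Sigma(x,s+1)=1$ when $f(x,s)\leq f(x,s+1)$ and $m^f_\Sigma(x,s+1)=-1$ when $f(x,s) > f(x,s+1)$; if $m^f_\Sigma(x,s)=-1$, then $m^f_\Sigma(x,s+1)=-1$ when $f(x,s)\geq f(x,s+1)$ and $m^f_\Sigma(x,s+1)=1$ when $f(x,s)<f(x,s+1)$. A fuzzy set $A$ is fuzzy $n$-c.e. ($n \geq 1$) if there is a computable $f\colon \omega\times\omega \to [0;1]_{\mathbb{Q}}$ such that for all $x$: $\lim_s f(x,s) = A(x)$, $f(x,0) = 0$, and $|\{s \in \omega : m^f_\Sigma(x,s+1)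 \neq m^f_\Sigma(x,s)\}| \leq n-1$. *)

theory Defs
  imports Complex_Main "HOL-Library.Nat_Bijection" "HOL-Library.Countable"
begin

text \<open>
  Partial recursive functions, presented as unary functions on the natural numbers: a function of
  several arguments receives them packed by \<^const>\<open>prod_encode\<close>. Since \<^const>\<open>prod_encode\<close> and its
  projections are primitive recursive, this yields the usual class. The identity is
  \<open>PairP FstP SndP\<close>; \<open>RecP p q\<close> is primitive recursion with parameter; \<open>MuP p\<close> is unbounded
  search, undefined if some value of \<open>p\<close> before the first zero is undefined.
\<close>

datatype prog =
    ZeroP
  | SuccP
  | FstP
  | SndP
  | PairP prog prog
  | CompP prog prog
  | RecP prog prog
  | MuP prog

inductive computes :: "prog \<Rightarrow> nat \<Rightarrow> nat \<Rightarrow> bool" where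
  zero: "computes ZeroP x 0"
| succ: "computes SuccP x (Suc x)"
| first: "computes FstP (prod_encode (x, y)) x"
| second: "computes SndP (prod_encode (x, y)) y"
| pair: "computes p x u \<Longrightarrow> computes q x v \<Longrightarrow> computes (PairP p q) x (prod_encode (u, v))"
| comp: "computes q x u \<Longrightarrow> computes p u v \<Longrightarrow> computes (CompP p q) x v"
| rec_0: "computes p x u \<Longrightarrow> computes (RecP p q) (prod_encode (x, 0)) u"
| rec_Suc: "computes (RecP p q) (prod_encode (x, n)) u \<Longrightarrow>
    computes q (prod_encode (x, prod_encode (n, u))) v \<Longrightarrow>
    computes (RecP p q) (prod_encode (x, Suc n)) v"
| mu: "computes p (prod_encode (x, n)) 0 \<Longrightarrow>
    (\<forall>m<n. \<exists>v. computes p (prod_encode (x, m)) (Suc v)) \<Longrightarrow>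
    computes (MuP p) x n"

text \<open>
  Rationals are coded through \<^const>\<open>nat_to_rat_surj\<close>, under which a rational has many codes. As
  equality of coded rationals is decidable, a least code can be found effectively, so the choice of
  code is immaterial.
\<close>

definition computable_unit_rat :: "(nat \<Rightarrow> nat \<Rightarrow> rat) \<Rightarrow> bool" where
  "computable_unit_rat f \<longleftrightarrow>
     (\<forall>x s. 0 \<le> f x s \<and> f x s \<le> 1) \<and>
     (\<exists>p. \<forall>x s. \<exists>c. computes p (prod_encode (x, s)) c \<and> nat_to_rat_surj c = f x s)"

definition fuzzy_set :: "(nat \<Rightarrow> real) \<Rightarrow> bool" where
  "fuzzy_set A \<longleftrightarrow> (\<forall>x. 0 \<le> A x \<and> A x \<le> 1)"

definition delta2_approximation :: "(nat \<Rightarrow> nat \<Rightarrow> rat) \<Rightarrow> (nat \<Rightarrow> real) \<Rightarrow> bool" where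
  "delta2_approximation f A \<longleftrightarrow>
     computable_unit_rat f \<and> (\<forall>x. (\<lambda>s. real_of_rat (f x s)) \<longlonglongrightarrow> A x)"

definition delta2_fuzzy_set :: "(nat \<Rightarrow> real) \<Rightarrow> bool" where
  "delta2_fuzzy_set A \<longleftrightarrow> fuzzy_set A \<and> (\<exists>f. delta2_approximation f A)"

primrec sigma_mind_change :: "(nat \<Rightarrow> nat \<Rightarrow> rat) \<Rightarrow> nat \<Rightarrow> nat \<Rightarrow> int" where
  "sigma_mind_change f x 0 = 1"
| "sigma_mind_change f x (Suc s) =
     (if sigma_mind_change f x s = 1
      then (if f x s \<le> f x (Suc s) then 1 else -1)
      else (if f x s \<ge> f x (Suc s) then -1 else 1))"

definition fuzzy_n_ce :: "nat \<Rightarrow> (nat \<Rightarrow> real) \<Rightarrow> bool" where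
  "fuzzy_n_ce n A \<longleftrightarrow> fuzzy_set A \<and>
     (\<exists>f. computable_unit_rat f \<and>
       (\<forall>x. (\<lambda>s. real_of_rat (f x s)) \<longlonglongrightarrow> A x \<and>
            f x 0 = 0 \<and>
            finite {s. sigma_mind_change f x (Suc s) \<noteq> sigma_mind_change f x s} \<and>
            card {s. sigma_mind_change f x (Suc s) \<noteq> sigma_mind_change f x s} \<le> n - 1))"

end

theory Submission
  imports Defs
begin

text \<open>
  If the mind changes of an approximation settle down, the approximation of \<open>A 0\<close> is eventually
  monotone. So it suffices to build a limit computable real \<open>\<alpha>\<close> that is not the limit of a monotone
  computable sequence of rationals. Write \<open>\<alpha>\<close> in base 4 with digits 0 and 3. Given the first \<open>e\<close>
  digits, let \<open>m\<close> be the midpoint of the interval they determine; if \<open>e\<close> codes a program for a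
  nondecreasing sequence, the next digit is 0 if some value of the sequence exceeds \<open>m\<close> and 3
  otherwise, so that \<open>m\<close> separates \<open>\<alpha>\<close> from the limit of the sequence. Nonincreasing sequences are
  treated symmetrically. Every digit answers a \<open>\<Sigma>\<^sub>1\<close> question about the preceding ones, so bounding
  the search by \<open>s\<close> yields approximations all of whose digits eventually settle.
\<close>

section \<open>Total recursive functions\<close>

abbreviation pair :: "nat \<Rightarrow> nat \<Rightarrow> nat" where
  "pair x y \<equiv> prod_encode (x, y)"

abbreviation pfst :: "nat \<Rightarrow> nat" where
  "pfst z \<equiv> fst (prod_decode z)"

abbreviation psnd :: "nat \<Rightarrow> nat" where
  "psnd z \<equiv> snd (prod_decode z)"

definition computable_fun :: "(nat \<Rightarrow> nat) \<Rightarrow> bool" where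
  "computable_fun f \<longleftrightarrow> (\<exists>p. \<forall>x. computes p x (f x))"

definition computable_pred :: "(nat \<Rightarrow> bool) \<Rightarrow> bool" where
  "computable_pred P \<longleftrightarrow> computable_fun (\<lambda>x. of_bool (P x))"

named_theorems computable_intros

lemma computes_FstP: "computes FstP z (pfst z)"
  using first[of "pfst z" "psnd z"] by simp

lemma computes_SndP: "computes SndP z (psnd z)"
  using second[of "pfst z" "psnd z"] by simp

lemma computable_fun_id [computable_intros]: "computable_fun (\<lambda>x. x)"
  unfolding computable_fun_def
proof (intro exI allI)
  fix x
  show "computes (PairP FstP SndP) x x"
    using computes.pair[OF computes_FstP[of x] computes_SndP[of x]] by simp
qed

lemma computable_fun_comp:
  assumes "computable_fun f" "computable_fun g"
  shows "computable_fun (\<lambda>x. f (g x))"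
  using assms unfolding computable_fun_def by (meson computes.comp)

lemma computable_fun_Suc [computable_intros]:
  assumes "computable_fun f"
  shows "computable_fun (\<lambda>x. Suc (f x))"
proof -
  have "computable_fun Suc"
    unfolding computable_fun_def using computes.succ by blast
  from computable_fun_comp[OF this assms] show ?thesis .
qed

lemma computable_fun_const [computable_intros]: "computable_fun (\<lambda>x. c)"
proof (induction c)
  case 0
  show ?case unfolding computable_fun_def using computes.zero by blast
next
  case (Suc c)
  then show ?case by (rule computable_fun_Suc)
qed

lemma computable_fun_pfst [computable_intros]:
  assumes "computable_fun f"
  shows "computable_fun (\<lambda>x. pfst (f x))"
  using assms unfolding computable_fun_def by (meson computes.comp computes_FstP)

lemma computable_fun_psnd [computable_intros]:
  assumes "computable_fun f"
  shows "computable_fun (\<lambda>x. psnd (f x))"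
  using assms unfolding computable_fun_def by (meson computes.comp computes_SndP)

lemma computable_fun_pair [computable_intros]:
  assumes "computable_fun f" "computable_fun g"
  shows "computable_fun (\<lambda>x. pair (f x) (g x))"
  using assms unfolding computable_fun_def by (meson computes.pair)

text \<open>\<open>RecP\<close> passes the whole input \<open>x\<close> along as its parameter, so
  the base and the step may both depend on it. The basic arithmetic operations below are shown
  computable by writing them as such a \<open>rec_nat\<close>.\<close>

lemma computable_fun_rec_nat [computable_intros]:
  assumes "computable_fun a" "computable_fun n"
    and "computable_fun (\<lambda>z. g (pfst z) (pfst (psnd z)) (psnd (psnd z)))"
  shows "computable_fun (\<lambda>x. rec_nat (a x) (\<lambda>k r. g x k r) (n x))"
proof -
  obtain pa pg where pa: "\<And>x. computes pa x (a x)"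
    and pg: "\<And>z. computes pg z (g (pfst z) (pfst (psnd z)) (psnd (psnd z)))"
    using assms unfolding computable_fun_def by blast
  have "computes (RecP pa pg) (pair x k) (rec_nat (a x) (g x) k)" for x k
  proof (induction k)
    case 0
    show ?case by (simp add: computes.rec_0 pa)
  next
    case (Suc k)
    have "computes pg (pair x (pair k (rec_nat (a x) (g x) k))) (rec_nat (a x) (g x) (Suc k))"
      using pg[of "pair x (pair k (rec_nat (a x) (g x) k))"] by simp
    with Suc show ?case by (rule computes.rec_Suc)
  qed
  then have "computes (RecP pa pg) z (rec_nat (a (pfst z)) (g (pfst z)) (psnd z))" for z
    by (metis prod.collapse prod_decode_inverse)
  then have "computable_fun (\<lambda>z. rec_nat (a (pfst z)) (g (pfst z)) (psnd z))"
    unfolding computable_fun_def by blast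
  from computable_fun_comp[OF this computable_fun_pair[OF computable_fun_id assms(2)]]
  show ?thesis by simp
qed

lemma computable_fun_of_bool [computable_intros]:
  "computable_pred P \<Longrightarrow> computable_fun (\<lambda>x. of_bool (P x))"
  by (simp add: computable_pred_def)

lemma computable_fun_if [computable_intros]:
  assumes "computable_pred P" "computable_fun f" "computable_fun g"
  shows "computable_fun (\<lambda>x. if P x then f x else g x)"
proof -
  \<comment> \<open>One round of recursion when \<open>P x\<close> holds, none otherwise.\<close>
  have eq: "(\<lambda>x. if P x then f x else g x) = (\<lambda>x. rec_nat (g x) (\<lambda>_ _. f x) (of_bool (P x)))"
    by auto
  have "computable_fun (\<lambda>z. f (pfst z))"
    by (intro computable_fun_comp[OF assms(2)] computable_intros)
  then show ?thesis
    unfolding eq by (intro computable_intros assms)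
qed

section \<open>Decidable predicates and elementary arithmetic\<close>

lemma computable_pred_not [computable_intros]:
  assumes "computable_pred P"
  shows "computable_pred (\<lambda>x. \<not> P x)"
proof -
  have eq: "(\<lambda>x. of_bool (\<not> P x)) = (\<lambda>x. if P x then 0 else 1 :: nat)" by auto
  show ?thesis
    unfolding computable_pred_def eq by (intro computable_intros assms)
qed

lemma computable_pred_conj [computable_intros]:
  assumes "computable_pred P" "computable_pred Q"
  shows "computable_pred (\<lambda>x. P x \<and> Q x)"
proof -
  have eq: "(\<lambda>x. of_bool (P x \<and> Q x)) = (\<lambda>x. if P x then of_bool (Q x) else 0 :: nat)" by auto
  show ?thesis
    unfolding computable_pred_def eq by (intro computable_intros assms)
qed

lemma computable_pred_disj [computable_intros]:
  assumes "computable_pred P" "computable_pred Q"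
  shows "computable_pred (\<lambda>x. P x \<or> Q x)"
proof -
  have eq: "(\<lambda>x. P x \<or> Q x) = (\<lambda>x. \<not> (\<not> P x \<and> \<not> Q x))" by auto
  show ?thesis unfolding eq by (intro computable_intros assms)
qed

lemma computable_pred_if [computable_intros]:
  assumes "computable_pred P" "computable_pred Q" "computable_pred R"
  shows "computable_pred (\<lambda>x. if P x then Q x else R x)"
proof -
  have eq: "(\<lambda>x. if P x then Q x else R x) = (\<lambda>x. P x \<and> Q x \<or> \<not> P x \<and> R x)" by auto
  show ?thesis unfolding eq by (intro computable_intros assms)
qed

lemma computable_pred_eq_0 [computable_intros]:
  assumes "computable_fun f"
  shows "computable_pred (\<lambda>x. f x = 0)"
proof -
  have eq: "(\<lambda>x. of_bool (f x = 0)) = (\<lambda>x. rec_nat 1 (\<lambda>_ _. 0) (f x) :: nat)"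
  proof
    fix x
    show "of_bool (f x = 0) = (rec_nat 1 (\<lambda>_ _. 0) (f x) :: nat)" by (cases "f x") auto
  qed
  show ?thesis
    unfolding computable_pred_def eq by (intro computable_intros assms)
qed

lemma computable_fun_diff [computable_intros]:
  assumes "computable_fun f" "computable_fun g"
  shows "computable_fun (\<lambda>x. f x - g x)"
proof -
  \<comment> \<open>The predecessor is the counter of the last round of a recursion; truncated
    subtraction iterates it.\<close>
  have pred: "n - 1 = rec_nat 0 (\<lambda>k _. k) n" for n by (cases n) auto
  have diff: "m - n = rec_nat m (\<lambda>_ r. rec_nat 0 (\<lambda>k _. k) r) n" for m n
    by (induction n) (simp_all flip: pred)
  show ?thesis unfolding diff by (intro computable_intros assms)
qed

lemma computable_pred_le [computable_intros]:
  assumes "computable_fun f" "computable_fun g"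
  shows "computable_pred (\<lambda>x. f x \<le> g x)"
  unfolding diff_is_0_eq[symmetric] by (intro computable_intros assms)

lemma computable_pred_less [computable_intros]:
  assumes "computable_fun f" "computable_fun g"
  shows "computable_pred (\<lambda>x. f x < g x)"
  unfolding Suc_le_eq[symmetric] by (intro computable_intros assms)

lemma computable_pred_eq [computable_intros]:
  assumes "computable_fun f" "computable_fun g"
  shows "computable_pred (\<lambda>x. f x = g x)"
  unfolding eq_iff by (intro computable_intros assms)

lemma computable_fun_add [computable_intros]:
  assumes "computable_fun f" "computable_fun g"
  shows "computable_fun (\<lambda>x. f x + g x)"
proof -
  have eq: "m + n = rec_nat m (\<lambda>_ r. Suc r) n" for m n by (induction n) auto
  show ?thesis unfolding eq by (intro computable_intros assms)
qed

lemma computable_fun_mult [computable_intros]: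
  assumes "computable_fun f" "computable_fun g"
  shows "computable_fun (\<lambda>x. f x * g x)"
proof -
  have eq: "m * n = rec_nat 0 (\<lambda>_ r. r + m) n" for m n :: nat by (induction n) auto
  have "computable_fun (\<lambda>z. f (pfst z))"
    by (intro computable_fun_comp[OF assms(1)] computable_intros)
  then show ?thesis unfolding eq by (intro computable_intros assms)
qed

lemma computable_fun_power [computable_intros]:
  assumes "computable_fun g"
  shows "computable_fun (\<lambda>x. c ^ g x)"
proof -
  have eq: "c ^ n = rec_nat 1 (\<lambda>_ r. c * r) n" for n by (induction n) auto
  show ?thesis unfolding eq by (intro computable_intros assms)
qed

lemma computable_pred_odd [computable_intros]:
  assumes "computable_fun f"
  shows "computable_pred (\<lambda>x. odd (f x))"
proof -
  have eq: "of_bool (odd n) = (rec_nat 0 (\<lambda>_ r. 1 - r) n :: nat)" for n :: nat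
    by (induction n) (auto simp flip: of_bool_not_iff)
  show ?thesis
    unfolding computable_pred_def eq by (intro computable_intros assms)
qed

lemma computable_fun_half [computable_intros]:
  assumes "computable_fun f"
  shows "computable_fun (\<lambda>x. f x div 2)"
proof -
  have eq: "n div 2 = rec_nat 0 (\<lambda>k r. if odd k then Suc r else r) n" for n :: nat
  proof (induction n)
    case (Suc n)
    have "Suc n div 2 = (if odd n then Suc (n div 2) else n div 2)" by auto
    with Suc show ?case by simp
  qed simp
  show ?thesis unfolding eq by (intro computable_intros assms)
qed

lemma computable_pred_set_decode [computable_intros]:
  assumes "computable_fun f" "computable_fun g"
  shows "computable_pred (\<lambda>x. f x \<in> set_decode (g x))"
proof -
  \<comment> \<open>Membership in \<open>set_decode\<close> asks for the parity of
    \<open>g x div 2 ^ f x\<close>, a quotient reached by repeated halving.\<close>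
  have eq: "m div 2 ^ n = rec_nat m (\<lambda>_ r. r div 2) n" for m n :: nat
    by (induction n) (simp_all add: div_mult2_eq power_Suc2 del: power_Suc)
  show ?thesis
    unfolding set_decode_def mem_Collect_eq eq by (intro computable_intros assms)
qed

section \<open>Bounded quantifiers and finite sums\<close>

lemma computable_pred_bex [computable_intros]:
  assumes "computable_pred (\<lambda>z. P (pfst z) (psnd z))" "computable_fun n"
  shows "computable_pred (\<lambda>x. \<exists>k<n x. P x k)"
proof -
  have eq: "of_bool (\<exists>k<m. P x k) = (rec_nat 0 (\<lambda>k r. if P x k then 1 else r) m :: nat)" for x m
  proof (induction m)
    case (Suc m)
    have "of_bool (\<exists>k<Suc m. P x k) = (if P x m then 1 else of_bool (\<exists>k<m. P x k) :: nat)"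
      by (auto simp: less_Suc_eq)
    then show ?case by (simp only: Suc old.nat.simps(7))
  qed simp
  \<comment> \<open>The recursion step is handed \<open>x\<close>, \<open>k\<close> and the previous
    result packed together; this map drops the result.\<close>
  have "computable_fun (\<lambda>z. pair (pfst z) (pfst (psnd z)))"
    by (intro computable_intros)
  from computable_fun_comp[OF computable_fun_of_bool[OF assms(1)] this]
  have P: "computable_pred (\<lambda>z. P (pfst z) (pfst (psnd z)))"
    by (simp add: computable_pred_def)
  show ?thesis
    unfolding computable_pred_def eq by (intro computable_intros P assms(2))
qed

lemma computable_pred_ball [computable_intros]:
  assumes "computable_pred (\<lambda>z. P (pfst z) (psnd z))" "computable_fun n"
  shows "computable_pred (\<lambda>x. \<forall>k<n x. P x k)"
proof -
  have eq: "(\<lambda>x. \<forall>k<n x. P x k) = (\<lambda>x. \<not> (\<exists>k<n x. \<not> P x k))" by auto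
  show ?thesis unfolding eq by (intro computable_intros assms)
qed

lemma computable_fun_sum [computable_intros]:
  assumes "computable_fun (\<lambda>z. h (pfst z) (psnd z))" "computable_fun n"
  shows "computable_fun (\<lambda>x. \<Sum>k<n x. h x k)"
proof -
  have eq: "(\<Sum>k<m. h x k) = rec_nat 0 (\<lambda>k r. r + h x k) m" for x m
    by (induction m) auto
  have "computable_fun (\<lambda>z. pair (pfst z) (pfst (psnd z)))"
    by (intro computable_intros)
  from computable_fun_comp[OF assms(1) this]
  have "computable_fun (\<lambda>z. h (pfst z) (pfst (psnd z)))"
    by simp
  then show ?thesis unfolding eq by (intro computable_intros assms(2))
qed

section \<open>A universal enumeration of computations\<close>

text \<open>Each constructor puts a tag in the first component, which \<open>derivable\<close>
  inspects; the zeros in second components are padding.\<close>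

primrec prog_code :: "prog \<Rightarrow> nat" where
  "prog_code ZeroP = pair 0 0"
| "prog_code SuccP = pair 1 0"
| "prog_code FstP = pair 2 0"
| "prog_code SndP = pair 3 0"
| "prog_code (PairP p q) = pair 4 (pair (prog_code p) (prog_code q))"
| "prog_code (CompP p q) = pair 5 (pair (prog_code p) (prog_code q))"
| "prog_code (RecP p q) = pair 6 (pair (prog_code p) (prog_code q))"
| "prog_code (MuP p) = pair 7 (pair (prog_code p) 0)"

abbreviation triple :: "nat \<Rightarrow> nat \<Rightarrow> nat \<Rightarrow> nat" where
  "triple a x y \<equiv> pair a (pair x y)"

text \<open>
  One backward application of a rule of \<^const>\<open>computes\<close> to the judgement \<open>(a, x, y)\<close>, where \<open>M\<close> codes
  the set of judgements already derived and \<open>n\<close> bounds the search for intermediate values.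
\<close>

definition derivable :: "nat \<Rightarrow> nat \<Rightarrow> nat \<Rightarrow> nat \<Rightarrow> nat \<Rightarrow> bool" where
  "derivable n M a x y \<longleftrightarrow>
     pfst a = 0 \<and> y = 0 \<or>
     pfst a = 1 \<and> y = Suc x \<or>
     pfst a = 2 \<and> y = pfst x \<or>
     pfst a = 3 \<and> y = psnd x \<or>
     pfst a = 4 \<and> triple (pfst (psnd a)) x (pfst y) \<in> set_decode M \<and>
       triple (psnd (psnd a)) x (psnd y) \<in> set_decode M \<or>
     pfst a = 5 \<and> (\<exists>u<n. triple (psnd (psnd a)) x u \<in> set_decode M \<and>
       triple (pfst (psnd a)) u y \<in> set_decode M) \<or>
     pfst a = 6 \<and> psnd x = 0 \<and> triple (pfst (psnd a)) (pfst x) y \<in> set_decode M \<or>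
     pfst a = 6 \<and> 0 < psnd x \<and> (\<exists>u<n. triple a (pair (pfst x) (psnd x - 1)) u \<in> set_decode M \<and>
       triple (psnd (psnd a)) (pair (pfst x) (pair (psnd x - 1) u)) y \<in> set_decode M) \<or>
     pfst a = 7 \<and> triple (pfst (psnd a)) (pair x y) 0 \<in> set_decode M \<and>
       (\<forall>m<y. \<exists>v<n. triple (pfst (psnd a)) (pair x m) (Suc v) \<in> set_decode M)"

text \<open>A finite set of judgements is a number whose bits are its members, as in
  \<open>set_encode\<close>. This makes the enumeration a recursion on natural numbers, and the
  bound \<open>t < n\<close> keeps every stage finite.\<close>

primrec stage :: "nat \<Rightarrow> nat" where
  "stage 0 = 0"
| "stage (Suc n) =
     (\<Sum>t<n. if derivable n (stage n) (pfst t) (pfst (psnd t)) (psnd (psnd t)) then 2 ^ t else 0)"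

lemma computable_pred_derivable:
  assumes "computable_fun n" "computable_fun M"
    "computable_fun a" "computable_fun x" "computable_fun y"
  shows "computable_pred (\<lambda>z. derivable (n z) (M z) (a z) (x z) (y z))"
proof -
  \<comment> \<open>Under a bounded quantifier the old variable becomes the first component of a
    pair; the clause for \<open>MuP\<close> nests two quantifiers, so two layers are needed.\<close>
  note shift = assms[THEN computable_fun_comp, of pfst]
    assms[THEN computable_fun_comp, of "\<lambda>z. pfst (pfst z)"]
  show ?thesis
    unfolding derivable_def by (intro assms shift computable_intros)
qed

lemma computable_fun_stage [computable_intros]:
  assumes "computable_fun f"
  shows "computable_fun (\<lambda>x. stage (f x))"
proof -
  have eq: "stage n = rec_nat 0 (\<lambda>n M. \<Sum>t<n.
      if derivable n M (pfst t) (pfst (psnd t)) (psnd (psnd t)) then 2 ^ t else 0) n" for n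
    by (induction n) auto
  show ?thesis
    unfolding eq by (intro computable_intros computable_pred_derivable assms)
qed

section \<open>Soundness and completeness of the stages\<close>

lemma mem_stage_Suc:
  "triple a x y \<in> set_decode (stage (Suc n)) \<longleftrightarrow> triple a x y < n \<and> derivable n (stage n) a x y"
proof -
  let ?D = "{t. t < n \<and> derivable n (stage n) (pfst t) (pfst (psnd t)) (psnd (psnd t))}"
  have "stage (Suc n) = set_encode ?D"
    unfolding set_encode_def by (simp add: sum.If_cases Int_def conj_commute)
  moreover have "finite ?D" by simp
  ultimately have "set_decode (stage (Suc n)) = ?D" by simp
  then show ?thesis by simp
qed

text \<open>The induction is on the stage and not on the program, because a round of
  \<open>RecP\<close> appeals to the same program at a smaller argument.\<close>

lemma stage_sound: "triple (prog_code p) x y \<in> set_decode (stage n) \<Longrightarrow> computes p x y"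
proof (induction n arbitrary: p x y)
  case 0
  then show ?case by simp
next
  case (Suc n)
  have x: "x = pair (pfst x) (psnd x)" and y: "y = pair (pfst y) (psnd y)" by simp_all
  have d: "derivable n (stage n) (prog_code p) x y"
    using Suc.prems by (simp only: mem_stage_Suc)
  show ?case
  proof (cases p)
    case ZeroP
    then show ?thesis using d by (auto simp: derivable_def intro: computes.zero)
  next
    case SuccP
    then show ?thesis using d by (auto simp: derivable_def intro: computes.succ)
  next
    case FstP
    then show ?thesis using d by (auto simp: derivable_def intro: computes_FstP)
  next
    case SndP
    then show ?thesis using d by (auto simp: derivable_def intro: computes_SndP)
  next
    case (PairP q r)
    then have "computes q x (pfst y)" "computes r x (psnd y)"
      using d Suc.IH by (auto simp: derivable_def)
    then show ?thesis using computes.pair y PairP by metis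
  next
    case (CompP q r)
    then obtain u where "computes r x u" "computes q u y"
      using d Suc.IH by (auto simp: derivable_def)
    then show ?thesis using computes.comp CompP by blast
  next
    case (RecP q r)
    show ?thesis
    proof (cases "psnd x")
      case 0
      then have "computes q (pfst x) y"
        using d Suc.IH RecP by (auto simp: derivable_def)
      then show ?thesis using computes.rec_0 x 0 RecP by metis
    next
      case (Suc k)
      then obtain u where "triple (prog_code p) (pair (pfst x) k) u \<in> set_decode (stage n)"
        "triple (prog_code r) (pair (pfst x) (pair k u)) y \<in> set_decode (stage n)"
        using d RecP by (auto simp: derivable_def)
      then have "computes p (pair (pfst x) k) u" "computes r (pair (pfst x) (pair k u)) y"
        using Suc.IH by blast+
      then show ?thesis using computes.rec_Suc x Suc RecP by metis
    qed
  next
    case (MuP q)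
    then have "computes q (pair x y) 0" "\<forall>m<y. \<exists>v. computes q (pair x m) (Suc v)"
      using d Suc.IH by (auto simp: derivable_def) blast
    then show ?thesis using computes.mu MuP by blast
  qed
qed

text \<open>Asking for all large stages, and not just for one, lets finitely many premises be
  combined without first showing that the stages increase.\<close>

lemma eventually_stageI:
  assumes "\<forall>\<^sub>F n in sequentially. derivable n (stage n) a x y"
  shows "\<forall>\<^sub>F n in sequentially. triple a x y \<in> set_decode (stage n)"
proof -
  have "\<forall>\<^sub>F n in sequentially. triple a x y \<in> set_decode (stage (Suc n))"
    using assms eventually_gt_at_top[of "triple a x y"]
    by eventually_elim (simp only: mem_stage_Suc)
  then show ?thesis
    using eventually_sequentially_Suc[of "\<lambda>n. triple a x y \<in> set_decode (stage n)"] by blast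
qed

lemma stage_complete:
  "computes p x y \<Longrightarrow> \<forall>\<^sub>F n in sequentially. triple (prog_code p) x y \<in> set_decode (stage n)"
proof (induction rule: computes.induct)
  case (pair p x u q v)
  show ?case
    by (rule eventually_stageI, use pair.IH in eventually_elim) (simp add: derivable_def)
next
  case (comp q x u p v)
  show ?case
    by (rule eventually_stageI, use comp.IH eventually_gt_at_top[of u] in eventually_elim)
      (auto simp: derivable_def)
next
  case (rec_0 p x u q)
  show ?case
    by (rule eventually_stageI, use rec_0.IH in eventually_elim) (simp add: derivable_def)
next
  case (rec_Suc p q x n u v)
  show ?case
    by (rule eventually_stageI, use rec_Suc.IH eventually_gt_at_top[of u] in eventually_elim)
      (auto simp: derivable_def)
next
  case (mu p x k)
  have "\<forall>\<^sub>F n in sequentially. \<exists>v<n. triple (prog_code p) (pair x m) (Suc v) \<in> set_decode (stage n)"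
    if "m < k" for m
  proof -
    obtain v where
      "\<forall>\<^sub>F n in sequentially. triple (prog_code p) (pair x m) (Suc v) \<in> set_decode (stage n)"
      using mu.IH \<open>m < k\<close> by blast
    then show ?thesis
      using eventually_gt_at_top[of v] by eventually_elim blast
  qed
  \<comment> \<open>Only finitely many arguments precede the first zero, so all large stages serve
    them together.\<close>
  then have *: "\<forall>\<^sub>F n in sequentially. \<forall>m\<in>{..<k}. \<exists>v<n.
      triple (prog_code p) (pair x m) (Suc v) \<in> set_decode (stage n)"
    by (intro eventually_ball_finite) auto
  show ?case
    by (rule eventually_stageI, use mu.IH(1) * in eventually_elim) (simp add: derivable_def)
qed (rule eventually_stageI; simp add: derivable_def)+

text \<open>Serves to identify an output found in the enumeration with the code that an
  approximation is known to produce.\<close>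

lemma computes_deterministic: "computes p x y \<Longrightarrow> computes p x z \<Longrightarrow> y = z"
proof (induction arbitrary: z rule: computes.induct)
  case (pair p x u q v)
  from pair.prems show ?case by cases (simp add: pair.IH)
next
  case (comp q x u p v)
  from comp.prems show ?case by cases (use comp.IH in blast)
next
  case (rec_0 p x u q)
  from rec_0.prems show ?case by cases (simp_all add: rec_0.IH)
next
  case (rec_Suc p q x n u v)
  from rec_Suc.prems show ?case by cases (use rec_Suc.IH in auto)
next
  case (mu p x n)
  from mu.prems obtain "computes p (pair x z) 0"
    and z: "\<And>m. m < z \<Longrightarrow> \<exists>v. computes p (pair x m) (Suc v)"
    by cases auto
  \<comment> \<open>If the two results differed, \<open>p\<close> would give both zero and a
    successor at the smaller one.\<close>
  with mu.IH have "\<not> z < n" by fastforce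
  moreover have "\<not> n < z" using mu.IH(1) z by fastforce
  ultimately show ?case by simp
qed (erule computes.cases; simp)+

section \<open>Codes of nonnegative rationals\<close>

text \<open>\<open>Suc n div 2\<close> is the absolute value of \<open>int_decode n\<close>.
  Dropping signs does no harm to a nonnegative quotient and keeps all comparisons within the natural
  numbers.\<close>

definition code_num :: "nat \<Rightarrow> nat" where
  "code_num c = Suc (pfst c) div 2"

definition code_den :: "nat \<Rightarrow> nat" where
  "code_den c = Suc (psnd c) div 2"

lemma abs_int_decode: "\<bar>int_decode n\<bar> = int (Suc n div 2)"
  by (cases "even n") (auto simp: int_decode_def sum_decode_def elim!: evenE oddE)

lemma int_decode_double: "int_decode (2 * n) = int n"
  by (simp add: int_decode_def sum_decode_def)

lemma nat_to_rat_surj_nonneg: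
  assumes "0 \<le> nat_to_rat_surj c"
  shows "real_of_rat (nat_to_rat_surj c) = real (code_num c) / real (code_den c)"
proof -
  let ?a = "int_decode (pfst c)" and ?b = "int_decode (psnd c)"
  have "nat_to_rat_surj c = \<bar>of_int ?a / of_int ?b\<bar>"
    using assms unfolding nat_to_rat_surj_def Fract_of_int_quotient split_beta Let_def
    by (simp only: abs_of_nonneg)
  also have "\<dots> = of_int \<bar>?a\<bar> / of_int \<bar>?b\<bar>" by simp
  also have "\<dots> = of_nat (code_num c) / of_nat (code_den c)"
    unfolding abs_int_decode code_num_def code_den_def by simp
  finally show ?thesis by (simp add: of_rat_divide)
qed

lemma nat_to_rat_surj_of_nat_quotient:
  "nat_to_rat_surj (pair (2 * a) (2 * b)) = of_nat a / of_nat b"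
  by (simp add: nat_to_rat_surj_def int_decode_double Fract_of_int_quotient)

text \<open>Cross multiplication turns the comparison into a decidable one between naturals. A zero
  denominator stands for the rational 0, which never exceeds \<open>m / k\<close>.\<close>

lemma code_greater_iff:
  assumes "0 < k"
  shows "real m / real k < real (code_num c) / real (code_den c) \<longleftrightarrow>
    0 < code_den c \<and> m * code_den c < code_num c * k"
proof (cases "code_den c = 0")
  case False
  then have "real m / real k < real (code_num c) / real (code_den c) \<longleftrightarrow>
      real (m * code_den c) < real (code_num c * k)"
    using assms by (simp add: field_simps)
  then show ?thesis using False by (simp only: of_nat_less_iff) simp
qed (simp add: not_less)

text \<open>Here a zero denominator always satisfies the inequality, since \<open>m / k\<close> is
  positive.\<close>

lemma code_less_iff:
  assumes "0 < k" "0 < m"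
  shows "real (code_num c) / real (code_den c) < real m / real k \<longleftrightarrow>
    code_den c = 0 \<or> code_num c * k < m * code_den c"
proof (cases "code_den c = 0")
  case False
  then have "real (code_num c) / real (code_den c) < real m / real k \<longleftrightarrow>
      real (code_num c * k) < real (m * code_den c)"
    using assms by (simp add: field_simps)
  then show ?thesis using False by (simp only: of_nat_less_iff) simp
qed (use assms in simp)

section \<open>The diagonal real\<close>

text \<open>
  Requirement \<open>e\<close> consists of a direction \<open>pfst e\<close>, where 0 stands for nondecreasing, and a program
  code \<open>psnd e\<close>. The first \<open>e\<close> digits form the number \<open>N\<close>, hence determine the interval from
  \<open>N / 4 ^ e\<close> to \<open>(N + 1) / 4 ^ e\<close>, whose midpoint is \<open>(4 * N + 2) / 4 ^ Suc e\<close>. A witness \<open>r\<close> packs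
  a stage, an input and the code of an output beyond the midpoint in the direction of \<open>e\<close>.
\<close>

definition witness :: "nat \<Rightarrow> nat \<Rightarrow> nat \<Rightarrow> bool" where
  "witness e N r \<longleftrightarrow>
     triple (psnd e) (pfst (psnd r)) (psnd (psnd r)) \<in> set_decode (stage (pfst r)) \<and>
     (if pfst e = 0
      then 0 < code_den (psnd (psnd r)) \<and>
        (4 * N + 2) * code_den (psnd (psnd r)) < code_num (psnd (psnd r)) * 4 ^ Suc e
      else code_den (psnd (psnd r)) = 0 \<or>
        code_num (psnd (psnd r)) * 4 ^ Suc e < (4 * N + 2) * code_den (psnd (psnd r)))"

text \<open>With the answers abstracted into \<open>Q\<close>, the bounded approximations and the
  true digits are instances of one recursion, and nesting is proved once for both.\<close>

primrec expansion :: "(nat \<Rightarrow> nat \<Rightarrow> bool) \<Rightarrow> nat \<Rightarrow> nat" where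
  "expansion Q 0 = 0"
| "expansion Q (Suc e) = 4 * expansion Q e +
     (if pfst e = 0 then if Q e (expansion Q e) then 0 else 3
      else if Q e (expansion Q e) then 3 else 0)"

definition approx :: "nat \<Rightarrow> nat \<Rightarrow> nat" where
  "approx s = expansion (\<lambda>e N. \<exists>r<s. witness e N r)"

definition digits :: "nat \<Rightarrow> nat" where
  "digits = expansion (\<lambda>e N. \<exists>r. witness e N r)"

section \<open>Computability and convergence of the approximations\<close>

lemma computable_pred_witness:
  assumes "computable_fun e" "computable_fun N" "computable_fun r"
  shows "computable_pred (\<lambda>x. witness (e x) (N x) (r x))"
  unfolding witness_def code_num_def code_den_def
  by (intro computable_intros assms)

lemma computable_fun_approx: "computable_fun (\<lambda>s. approx s s)"
proof -
  have eq: "approx s e = rec_nat 0 (\<lambda>e N. 4 * N +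
      (if pfst e = 0 then if \<exists>r<s. witness e N r then 0 else 3
       else if \<exists>r<s. witness e N r then 3 else 0)) e" for s e
    by (induction e) (simp_all add: approx_def)
  show ?thesis
    unfolding eq by (intro computable_intros computable_pred_witness)
qed

text \<open>Each new digit selects the first or the last quarter of the current interval.\<close>

lemma expansion_nested:
  assumes "e \<le> s"
  shows "real (expansion Q e) / 4 ^ e \<le> real (expansion Q s) / 4 ^ s \<and>
    (real (expansion Q s) + 1) / 4 ^ s \<le> (real (expansion Q e) + 1) / 4 ^ e"
  using assms
proof (induction s rule: dec_induct)
  case (step s)
  have "real (expansion Q s) / 4 ^ s \<le> real (expansion Q (Suc s)) / 4 ^ Suc s"
    "(real (expansion Q (Suc s)) + 1) / 4 ^ Suc s \<le> (real (expansion Q s) + 1) / 4 ^ s"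
    by (auto simp: field_simps)
  with step.IH show ?case by linarith
qed simp

text \<open>Once the preceding digits have settled, the question asked is the final one. A true
  answer appears at some bound and persists; a false one is correct at every bound.\<close>

lemma eventually_approx_eq_digits: "\<forall>\<^sub>F s in sequentially. approx s e = digits e"
proof (induction e)
  case (Suc e)
  have "\<forall>\<^sub>F s in sequentially. (\<exists>r<s. witness e N r) \<longleftrightarrow> (\<exists>r. witness e N r)" for N
  proof (cases "\<exists>r. witness e N r")
    case True
    then obtain r where "witness e N r" by blast
    show ?thesis
      using eventually_gt_at_top[of r] by eventually_elim (use \<open>witness e N r\<close> in blast)
  qed simp
  from Suc this[of "digits e"] show ?case
    by eventually_elim (simp add: approx_def digits_def)
qed (simp add: approx_def digits_def)

text \<open>Only the first \<open>e\<close> digits of \<open>approx s s\<close> have to be right: by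
  nesting, the later ones cannot leave the interval.\<close>

lemma eventually_approx_bounds:
  "\<forall>\<^sub>F s in sequentially. real (digits e) / 4 ^ e \<le> real (approx s s) / 4 ^ s \<and>
    real (approx s s) / 4 ^ s \<le> (real (digits e) + 1) / 4 ^ e"
  using eventually_approx_eq_digits[of e] eventually_ge_at_top[of e]
proof eventually_elim
  case (elim s)
  have "real (approx s s) / 4 ^ s \<le> (real (approx s s) + 1) / 4 ^ s"
    by (simp add: divide_right_mono)
  with expansion_nested[OF elim(2), of "\<lambda>e N. \<exists>r<s. witness e N r"] elim(1)
  show ?case unfolding approx_def by auto
qed

lemma diagonal_real_exists:
  obtains \<alpha> where "(\<lambda>s. real (approx s s) / 4 ^ s) \<longlonglongrightarrow> \<alpha>"
    "\<And>e. real (digits e) / 4 ^ e \<le> \<alpha>" "\<And>e. \<alpha> \<le> (real (digits e) + 1) / 4 ^ e"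
proof -
  let ?g = "\<lambda>s. real (approx s s) / 4 ^ s"
  have "Cauchy ?g"
  proof (rule metric_CauchyI)
    fix \<epsilon> :: real assume "0 < \<epsilon>"
    then obtain e where e: "(1 / 4) ^ e < \<epsilon>"
      using real_arch_pow_inv[of \<epsilon> "1 / 4"] by auto
    obtain M where M: "\<And>s. M \<le> s \<Longrightarrow> real (digits e) / 4 ^ e \<le> ?g s \<and>
        ?g s \<le> (real (digits e) + 1) / 4 ^ e"
      using eventually_approx_bounds[of e] unfolding eventually_sequentially by blast
    have "dist (?g s) (?g t) < \<epsilon>" if "M \<le> s" "M \<le> t" for s t
    proof -
      have "dist (?g s) (?g t) \<le> (real (digits e) + 1) / 4 ^ e - real (digits e) / 4 ^ e"
        using M[OF that(1)] M[OF that(2)] unfolding dist_real_def by linarith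
      also have "\<dots> = (1 / 4) ^ e" by (simp add: field_simps power_divide)
      finally show ?thesis using e by simp
    qed
    then show "\<exists>M. \<forall>s\<ge>M. \<forall>t\<ge>M. dist (?g s) (?g t) < \<epsilon>" by blast
  qed
  then obtain \<alpha> where lim: "?g \<longlonglongrightarrow> \<alpha>"
    using Cauchy_convergent convergent_def by blast
  have "real (digits e) / 4 ^ e \<le> \<alpha>" for e
    using eventually_approx_bounds[of e]
    by (intro tendsto_lowerbound[OF lim]) (auto elim: eventually_mono)
  moreover have "\<alpha> \<le> (real (digits e) + 1) / 4 ^ e" for e
    using eventually_approx_bounds[of e]
    by (intro tendsto_upperbound[OF lim]) (auto elim: eventually_mono)
  ultimately show ?thesis using lim that by blast
qed

section \<open>Diagonalisation against monotone computable sequences\<close>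

lemma ex_witness_iff:
  assumes g: "\<And>i. \<exists>c. computes p i c \<and> nat_to_rat_surj c = g i" "\<And>i. 0 \<le> g i"
    and e: "e = pair k (prog_code p)"
  shows "(\<exists>r. witness e N r) \<longleftrightarrow>
    (\<exists>i. if k = 0 then (4 * real N + 2) / 4 ^ Suc e < real_of_rat (g i)
         else real_of_rat (g i) < (4 * real N + 2) / 4 ^ Suc e)"
proof -
  have mid: "(4 * real N + 2) / 4 ^ Suc e = real (4 * N + 2) / real (4 ^ Suc e)" by simp
  have iff: "witness e N (pair n (pair i c)) \<longleftrightarrow>
      triple (prog_code p) i c \<in> set_decode (stage n) \<and>
      (if k = 0 then (4 * real N + 2) / 4 ^ Suc e < real_of_rat (g i)
       else real_of_rat (g i) < (4 * real N + 2) / 4 ^ Suc e)"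
    if "nat_to_rat_surj c = g i" for n i c
  proof -
    have gi: "real_of_rat (g i) = real (code_num c) / real (code_den c)"
      using nat_to_rat_surj_nonneg[of c] that g(2)[of i] by simp
    have pos: "0 < (4 :: nat) ^ Suc e" "0 < 4 * N + 2" by simp_all
    show ?thesis
      unfolding witness_def mid gi code_greater_iff[OF pos(1)] code_less_iff[OF pos]
      by (simp add: e)
  qed
  show ?thesis
  proof
    assume "\<exists>r. witness e N r"
    then obtain n i c where w: "witness e N (pair n (pair i c))"
      by (metis prod.collapse prod_decode_inverse)
    \<comment> \<open>Soundness turns the enumerated triple into a genuine computation; determinism
      then forces its output to be a code of \<open>g i\<close>.\<close>
    then have "computes p i c" by (intro stage_sound[of p i c n]) (simp add: witness_def e)
    then have "nat_to_rat_surj c = g i" using g(1)[of i] computes_deterministic by blast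
    from iff[OF this] w
    show "\<exists>i. if k = 0 then (4 * real N + 2) / 4 ^ Suc e < real_of_rat (g i)
         else real_of_rat (g i) < (4 * real N + 2) / 4 ^ Suc e" by blast
  next
    assume "\<exists>i. if k = 0 then (4 * real N + 2) / 4 ^ Suc e < real_of_rat (g i)
         else real_of_rat (g i) < (4 * real N + 2) / 4 ^ Suc e"
    then obtain i where i: "if k = 0 then (4 * real N + 2) / 4 ^ Suc e < real_of_rat (g i)
         else real_of_rat (g i) < (4 * real N + 2) / 4 ^ Suc e" by blast
    obtain c where c: "computes p i c" "nat_to_rat_surj c = g i" using g(1) by blast
    obtain n where "triple (prog_code p) i c \<in> set_decode (stage n)"
      using eventually_happens'[OF _ stage_complete[OF c(1)]] by auto
    with iff[OF c(2)] i show "\<exists>r. witness e N r" by blast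
  qed
qed

lemma diagonal_real_not_monotone_limit:
  assumes \<alpha>: "\<And>e. real (digits e) / 4 ^ e \<le> \<alpha>" "\<And>e. \<alpha> \<le> (real (digits e) + 1) / 4 ^ e"
    and g: "\<And>i. \<exists>c. computes p i c \<and> nat_to_rat_surj c = g i" "\<And>i. 0 \<le> g i"
    and lim: "(\<lambda>i. real_of_rat (g i)) \<longlonglongrightarrow> \<alpha>"
  shows "\<not> incseq g" and "\<not> decseq g"
proof -
  define m where "m e = (4 * real (digits e) + 2) / 4 ^ Suc e" for e
  \<comment> \<open>In units of 1 / \<open>4 ^ Suc e\<close> and with N = \<open>digits e\<close>,
    digit 0 puts \<alpha> at most at 4N+1 and digit 3 at least at 4N+3, while the midpoint is 4N+2.
    The gaps keep the separation strict.\<close>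
  have left: "\<alpha> < m e" if "digits (Suc e) = 4 * digits e" for e
  proof -
    have "\<alpha> \<le> (4 * real (digits e) + 1) / 4 ^ Suc e"
      using \<alpha>(2)[of "Suc e"] that by simp
    also have "\<dots> < m e" unfolding m_def by (intro divide_strict_right_mono) auto
    finally show ?thesis .
  qed
  have right: "m e < \<alpha>" if "digits (Suc e) = 4 * digits e + 3" for e
  proof -
    have "m e < (4 * real (digits e) + 3) / 4 ^ Suc e"
      unfolding m_def by (intro divide_strict_right_mono) auto
    also have "\<dots> \<le> \<alpha>" using \<alpha>(1)[of "Suc e"] that by simp
    finally show ?thesis .
  qed
  have digits_Suc: "digits (Suc e) = 4 * digits e +
     (if pfst e = 0 then if \<exists>r. witness e (digits e) r then 0 else 3
      else if \<exists>r. witness e (digits e) r then 3 else 0)" for e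
    by (simp add: digits_def)
  show "\<not> incseq g"
  proof
    assume "incseq g"
    then have le: "real_of_rat (g i) \<le> \<alpha>" for i
      by (intro incseq_le[OF _ lim]) (simp add: incseq_def of_rat_less_eq)
    \<comment> \<open>The requirement aimed at \<open>p\<close> itself. If a value of
      \<open>g\<close> passes the midpoint, so does its limit, but digit 0 holds \<alpha> below; if
      none does, the limit is at most the midpoint, but digit 3 holds \<alpha> above.\<close>
    define e where "e = pair 0 (prog_code p)"
    note iff = ex_witness_iff[OF g e_def, of "digits e"]
    show False
    proof (cases "\<exists>i. m e < real_of_rat (g i)")
      case True
      then have "\<alpha> < m e" using iff digits_Suc[of e] left[of e] by (simp add: m_def e_def)
      with True le show False by (meson less_asym' less_le_trans)
    next
      case False
      then have "m e < \<alpha>" using iff digits_Suc[of e] right[of e] by (simp add: m_def e_def)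
      moreover have "\<alpha> \<le> m e"
        using False by (intro tendsto_upperbound[OF lim]) (auto simp: not_less)
      ultimately show False by simp
    qed
  qed
  show "\<not> decseq g"
  proof
    assume "decseq g"
    then have le: "\<alpha> \<le> real_of_rat (g i)" for i
      by (intro decseq_ge[OF _ lim]) (simp add: decseq_def of_rat_less_eq)
    \<comment> \<open>Any nonzero first component would select the mirrored direction.\<close>
    define e where "e = pair 1 (prog_code p)"
    note iff = ex_witness_iff[OF g e_def, of "digits e"]
    show False
    proof (cases "\<exists>i. real_of_rat (g i) < m e")
      case True
      then have "m e < \<alpha>" using iff digits_Suc[of e] right[of e] by (simp add: m_def e_def)
      with True le show False by (meson less_asym' less_le_trans)
    next
      case False
      then have "\<alpha> < m e" using iff digits_Suc[of e] left[of e] by (simp add: m_def e_def)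
      moreover have "m e \<le> \<alpha>"
        using False by (intro tendsto_lowerbound[OF lim]) (auto simp: not_less)
      ultimately show False by simp
    qed
  qed
qed

section \<open>Mind changes\<close>

text \<open>A convergent sequence of integers is eventually constant. Staying at 1 excludes every
  later strict decrease of \<open>f x\<close>, staying elsewhere every strict increase.\<close>

lemma convergent_sigma_mind_change_imp_monotone:
  assumes "convergent (sigma_mind_change f x)"
  obtains k where "incseq (\<lambda>s. f x (s + k)) \<or> decseq (\<lambda>s. f x (s + k))"
proof -
  from assms obtain l where "sigma_mind_change f x \<longlonglongrightarrow> l"
    unfolding convergent_def by blast
  then have "\<forall>\<^sub>F s in sequentially. sigma_mind_change f x s = l"
    by (simp add: tendsto_discrete)
  then obtain k where k: "\<And>s. k \<le> s \<Longrightarrow> sigma_mind_change f x s = l"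
    unfolding eventually_sequentially by blast
  have *: "sigma_mind_change f x (s + k) = l" "sigma_mind_change f x (Suc (s + k)) = l" for s
    by (rule k; simp)+
  show ?thesis
  proof (cases "l = 1")
    case True
    have "f x (s + k) \<le> f x (Suc (s + k))" for s
      using *[of s] True by (auto split: if_splits)
    then show ?thesis using that[of k] by (simp add: incseq_Suc_iff)
  next
    case False
    then have "f x (Suc (s + k)) \<le> f x (s + k)" for s
      using *[of s] by (auto split: if_splits)
    then show ?thesis using that[of k] by (simp add: decseq_Suc_iff)
  qed
qed

lemma finite_mind_changes_imp_convergent:
  assumes "finite {s. sigma_mind_change f x (Suc s) \<noteq> sigma_mind_change f x s}"
  shows "convergent (sigma_mind_change f x)"
proof -
  obtain k where k: "\<And>s. sigma_mind_change f x (Suc s) \<noteq> sigma_mind_change f x s \<Longrightarrow> s < k"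
    using assms unfolding finite_nat_set_iff_bounded by blast
  have "sigma_mind_change f x s = sigma_mind_change f x k" if "k \<le> s" for s
    using that
  proof (induction s rule: dec_induct)
    case (step s)
    then show ?case using k[of s] by linarith
  qed simp
  then have "sigma_mind_change f x \<longlonglongrightarrow> sigma_mind_change f x k"
    unfolding tendsto_discrete eventually_sequentially by blast
  then show ?thesis by (rule convergentI)
qed

theorem proposition5:
  shows "\<exists>A :: nat \<Rightarrow> real.
    delta2_fuzzy_set A \<and>
    (\<forall>f. delta2_approximation f A \<longrightarrow> \<not> convergent (\<lambda>s. sigma_mind_change f 0 s)) \<and>
    (\<forall>n\<ge>1. \<not> fuzzy_n_ce n A)"
proof -
  obtain \<alpha> where lim: "(\<lambda>s. real (approx s s) / 4 ^ s) \<longlonglongrightarrow> \<alpha>"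
    and \<alpha>: "\<And>e. real (digits e) / 4 ^ e \<le> \<alpha>" "\<And>e. \<alpha> \<le> (real (digits e) + 1) / 4 ^ e"
    using diagonal_real_exists by blast
  \<comment> \<open>The claim concerns the argument 0 alone, so a constant fuzzy set
    suffices.\<close>
  define A where "A = (\<lambda>x :: nat. \<alpha>)"
  define h :: "nat \<Rightarrow> nat \<Rightarrow> rat" where "h x s = of_nat (approx s s) / of_nat (4 ^ s)" for x s
  have fuzzy: "fuzzy_set A"
    \<comment> \<open>Before any digit is chosen the interval is that from 0 to 1.\<close>
    using \<alpha>[of 0] by (simp add: fuzzy_set_def A_def digits_def)
  have h_real: "real_of_rat (h x s) = real (approx s s) / 4 ^ s" for x s
    by (simp add: h_def of_rat_divide of_rat_power)
  \<comment> \<open>Even numbers code the nonnegative integers under \<open>int_decode\<close>,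
    hence the factors 2.\<close>
  have "computable_fun (\<lambda>z. pair (2 * approx (psnd z) (psnd z)) (2 * 4 ^ psnd z))"
    by (intro computable_intros computable_fun_comp[OF computable_fun_approx])
  then obtain p where p: "\<And>z. computes p z (pair (2 * approx (psnd z) (psnd z)) (2 * 4 ^ psnd z))"
    unfolding computable_fun_def by blast
  have "computable_unit_rat h"
    unfolding computable_unit_rat_def
  proof (intro conjI exI[of _ p] allI)
    fix x s
    show "0 \<le> h x s" by (simp add: h_def)
    have "(real (approx s s) + 1) / 4 ^ s \<le> 1"
      using expansion_nested[of 0 s] unfolding approx_def by simp
    then have "real_of_rat (h x s) \<le> real_of_rat 1"
      unfolding h_real add_divide_distrib of_rat_1
      by (smt (verit) zero_less_divide_1_iff zero_less_power)
    then show "h x s \<le> 1" by (simp only: of_rat_less_eq)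
    show "\<exists>c. computes p (pair x s) c \<and> nat_to_rat_surj c = h x s"
      using p[of "pair x s"] nat_to_rat_surj_of_nat_quotient[of "approx s s" "4 ^ s"]
      unfolding h_def by auto
  qed
  then have "delta2_approximation h A"
    using lim by (simp add: delta2_approximation_def h_real A_def)
  with fuzzy have delta2: "delta2_fuzzy_set A"
    unfolding delta2_fuzzy_set_def by blast
  have not_conv: "\<not> convergent (sigma_mind_change f 0)" if f: "delta2_approximation f A" for f
  proof
    assume "convergent (sigma_mind_change f 0)"
    then obtain k where mono: "incseq (\<lambda>s. f 0 (s + k)) \<or> decseq (\<lambda>s. f 0 (s + k))"
      by (rule convergent_sigma_mind_change_imp_monotone)
    have nonneg: "0 \<le> f 0 (i + k)" for i
      using f by (simp add: delta2_approximation_def computable_unit_rat_def)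
    obtain q where q: "\<And>s. \<exists>c. computes q (pair 0 s) c \<and> nat_to_rat_surj c = f 0 s"
      using f unfolding delta2_approximation_def computable_unit_rat_def by blast
    \<comment> \<open>The diagonalisation treats sequences monotone from the start, so the tail
      beginning at \<open>k\<close> gets a program of its own.\<close>
    have "computable_fun (\<lambda>i. pair 0 (i + k))" by (intro computable_intros)
    then obtain r where "\<And>i. computes r i (pair 0 (i + k))"
      unfolding computable_fun_def by blast
    with q have g: "\<exists>c. computes (CompP q r) i c \<and> nat_to_rat_surj c = f 0 (i + k)" for i
      using computes.comp by blast
    have g_lim: "(\<lambda>i. real_of_rat (f 0 (i + k))) \<longlonglongrightarrow> \<alpha>"
      using f by (intro LIMSEQ_ignore_initial_segment) (simp add: delta2_approximation_def A_def)
    show False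
      using diagonal_real_not_monotone_limit[OF \<alpha> g nonneg g_lim] mono by blast
  qed
  moreover have "\<not> fuzzy_n_ce n A" for n
  proof
    assume "fuzzy_n_ce n A"
    then obtain f where "delta2_approximation f A"
      "finite {s. sigma_mind_change f 0 (Suc s) \<noteq> sigma_mind_change f 0 s}"
      unfolding fuzzy_n_ce_def delta2_approximation_def by blast
    with not_conv finite_mind_changes_imp_convergent show False by blast
  qed
  ultimately show ?thesis using delta2 by blast
qed

end
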